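(* For every integer $d\ge 1$, the ML degree of the $d$-cube $C_d = [-1,1]^d$ is $2^d$.
   Context: For a lattice polytope $P \subset \mathbb{R}^d$ with lattice points $P\cap\mathbb{Z}^d = \{a_1,\dots,a_n\}$, the design matrix is $A = [a_1\ \cdots\ a_n] \in \mathbb{Z}^{d\times n}$, and $A'$ is $A$ with an additional first row of ones. The toric variety $V = V_A\subseteq \mathbb{C}^n$ (standard scaling) is the Zariski closure of the image of $\psi:(\mathbb{C}^* )^{d+1}\to(\mathbb{C}^* )^n$, $(s,\theta)\mapsto (s\theta^{a_1},\dots,s\theta^{a_n})$. For data $u\in\mathbb{N}^n$ with $u_+ = \sum_i u_i$, the score equations are $A'p = \frac{1}{u_+}A'u$ with $p\in V\cap(\mathbb{C}^* )^n$, and the ML degree of $P$ is the number of complex solutions $p$ for generic $u$. *)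

theory Defs
  imports "HOL-Analysis.Analysis" "HOL-Library.Poly_Mapping"
    "HOL-Computational_Algebra.Polynomial"
begin

section \<open>Zariski closure in a finite coordinate space\<close>

text \<open>
  Affine space \<open>\<complex>\<^sup>L\<close> over an index set \<open>L\<close> is \<open>L \<rightarrow>\<^sub>E UNIV\<close>: functions that are
  \<open>undefined\<close> outside \<open>L\<close>, so that equality of points is equality of coordinates on \<open>L\<close> and
  points can be counted.  Polynomials are finitely supported maps from monomials to
  coefficients.
\<close>

type_synonym 'v cpoly = "('v \<Rightarrow>\<^sub>0 nat) \<Rightarrow>\<^sub>0 complex"

definition cpolys :: "'v set \<Rightarrow> 'v cpoly set" where
  "cpolys L = {f. \<forall>m \<in> Poly_Mapping.keys f. Poly_Mapping.keys m \<subseteq> L}"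

definition eval_cpoly :: "'v cpoly \<Rightarrow> ('v \<Rightarrow> complex) \<Rightarrow> complex" where
  "eval_cpoly f x =
     (\<Sum>m \<in> Poly_Mapping.keys f. Poly_Mapping.lookup f m *
        (\<Prod>v \<in> Poly_Mapping.keys m. x v ^ Poly_Mapping.lookup m v))"

definition zariski_closure :: "'v set \<Rightarrow> ('v \<Rightarrow> complex) set \<Rightarrow> ('v \<Rightarrow> complex) set" where
  "zariski_closure L S =
     {x \<in> L \<rightarrow>\<^sub>E UNIV. \<forall>f \<in> cpolys L. (\<forall>y\<in>S. eval_cpoly f y = 0) \<longrightarrow> eval_cpoly f x = 0}"

section \<open>The toric variety of a lattice polytope\<close>

text \<open>
  The lattice points \<open>a\<^sub>1, \<dots>, a\<^sub>n\<close> of \<open>P \<subseteq> \<real>\<^sup>d\<close> (with \<open>d = CARD('d)\<close>) are not enumerated;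
  they serve themselves as the index set of the columns of the design matrix and of the
  coordinates of \<open>\<complex>\<^sup>n\<close>.
\<close>

definition lattice_points :: "(real^'d) set \<Rightarrow> (int^'d) set" where
  "lattice_points P = {a. (\<chi> i. real_of_int (a $ i)) \<in> P}"

definition design_matrix :: "'d \<Rightarrow> int^'d \<Rightarrow> int" where
  "design_matrix i a = a $ i"

text \<open>The matrix \<open>A'\<close>; the additional row of ones is the row \<open>None\<close>.\<close>

definition ext_design_matrix :: "'d option \<Rightarrow> int^'d \<Rightarrow> int" where
  "ext_design_matrix r a = (case r of None \<Rightarrow> 1 | Some i \<Rightarrow> design_matrix i a)"

definition monomial_map ::
  "(int^'d) set \<Rightarrow> complex \<Rightarrow> complex^'d \<Rightarrow> (int^'d \<Rightarrow> complex)" where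
  "monomial_map L s \<theta> = (\<lambda>a\<in>L. s * (\<Prod>i\<in>UNIV. (\<theta> $ i) powi design_matrix i a))"

definition toric_variety :: "(real^'d) set \<Rightarrow> (int^'d \<Rightarrow> complex) set" where
  "toric_variety P =
     zariski_closure (lattice_points P)
       {monomial_map (lattice_points P) s \<theta> | s \<theta>. s \<noteq> 0 \<and> (\<forall>i. \<theta> $ i \<noteq> 0)}"

section \<open>Score equations and ML degree\<close>

definition data_total :: "(real^'d) set \<Rightarrow> (int^'d \<Rightarrow> nat) \<Rightarrow> nat" where
  "data_total P u = (\<Sum>a \<in> lattice_points P. u a)"

definition score_solutions ::
  "(real^'d) set \<Rightarrow> (int^'d \<Rightarrow> nat) \<Rightarrow> (int^'d \<Rightarrow> complex) set" where
  "score_solutions P u =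
     {p \<in> toric_variety P \<inter> (lattice_points P \<rightarrow>\<^sub>E (- {0})).
        \<forall>r. (\<Sum>a \<in> lattice_points P. of_int (ext_design_matrix r a) * p a) =
            1 / of_nat (data_total P u) *
              (\<Sum>a \<in> lattice_points P. of_int (ext_design_matrix r a) * of_nat (u a))}"

text \<open>
  ``Generic'' means: for all data off the zero locus of some nonzero polynomial.  Data with
  \<open>u\<^sub>+ = 0\<close>, for which the score equations make no sense, are excluded explicitly.  The
  notion is meant for lattice polytopes, that is, nonempty bounded \<open>P\<close>; see the uniqueness
  statement below.
\<close>

definition has_ML_degree :: "(real^'d) set \<Rightarrow> nat \<Rightarrow> bool" where
  "has_ML_degree P k \<longleftrightarrow>
     (\<exists>f \<in> cpolys (lattice_points P). f \<noteq> 0 \<and>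
        (\<forall>u :: int^'d \<Rightarrow> nat.
           data_total P u > 0 \<and> eval_cpoly f (\<lambda>a. of_nat (u a)) \<noteq> 0 \<longrightarrow>
             finite (score_solutions P u) \<and> card (score_solutions P u) = k))"

definition cube :: "(real^'d) set" where
  "cube = {x. \<forall>i. x $ i \<in> {-1..1}}"

section \<open>Uniqueness of the ML degree\<close>

lemma separating_weights:
  fixes M :: "('v \<Rightarrow> nat) set"
  assumes "finite L" "finite M"
  shows "\<exists>w :: 'v \<Rightarrow> nat. \<forall>m\<in>M. \<forall>m'\<in>M.
           (\<Sum>a\<in>L. m a * w a) = (\<Sum>a\<in>L. m' a * w a) \<longrightarrow> (\<forall>a\<in>L. m a = m' a)"
  using assms(1)
proof (induction L rule: finite_induct)
  case empty
  then show ?case by simp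
next
  case (insert x L)
  then obtain w :: "'v \<Rightarrow> nat" where
    w: "\<And>m m'. m \<in> M \<Longrightarrow> m' \<in> M \<Longrightarrow> (\<Sum>a\<in>L. m a * w a) = (\<Sum>a\<in>L. m' a * w a) \<Longrightarrow>
           \<forall>a\<in>L. m a = m' a"
    by blast
  define B where "B = Suc (\<Sum>m\<in>M. m x)"
  have B: "m x < B" if "m \<in> M" for m
    unfolding B_def using member_le_sum[of m M "\<lambda>m. m x"] that assms(2) by simp
  define w' where "w' = (\<lambda>a. if a = x then 1 else B * w a)"
  have *: "(\<Sum>a\<in>insert x L. m a * w' a) = m x + B * (\<Sum>a\<in>L. m a * w a)" for m
  proof -
    have "(\<Sum>a\<in>L. m a * w' a) = (\<Sum>a\<in>L. B * (m a * w a))"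
      using insert.hyps by (intro sum.cong) (auto simp: w'_def)
    then show ?thesis
      using insert.hyps by (simp add: w'_def sum_distrib_left)
  qed
  have "\<forall>a\<in>insert x L. m a = m' a"
    if m: "m \<in> M" "m' \<in> M" and
       eq: "(\<Sum>a\<in>insert x L. m a * w' a) = (\<Sum>a\<in>insert x L. m' a * w' a)" for m m'
  proof -
    have eq': "m x + B * (\<Sum>a\<in>L. m a * w a) = m' x + B * (\<Sum>a\<in>L. m' a * w a)"
      using eq by (simp only: *)
    have 1: "m x = m' x"
      using arg_cong[OF eq', of "\<lambda>z. z mod B"] B[OF m(1)] B[OF m(2)] by simp
    with eq' have "(\<Sum>a\<in>L. m a * w a) = (\<Sum>a\<in>L. m' a * w a)"
      using B[OF m(1)] by (metis add_left_cancel mult_left_cancel not_less_zero)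
    with w[OF m] 1 show ?thesis by simp
  qed
  then show ?case by blast
qed

lemma generic_nat_point:
  fixes f g :: "'v cpoly"
  assumes "finite L" "f \<in> cpolys L" "g \<in> cpolys L" "f \<noteq> 0" "g \<noteq> 0"
  shows "\<exists>u :: 'v \<Rightarrow> nat. (\<forall>a. u a > 0) \<and>
           eval_cpoly f (\<lambda>a. of_nat (u a)) \<noteq> 0 \<and> eval_cpoly g (\<lambda>a. of_nat (u a)) \<noteq> 0"
proof -
  define K where "K = Poly_Mapping.keys f \<union> Poly_Mapping.keys g"
  have finK: "finite K" by (simp add: K_def)
  have KL: "Poly_Mapping.keys m \<subseteq> L" if "m \<in> K" for m
    using that assms(2,3) by (auto simp: K_def cpolys_def)
  obtain w :: "'v \<Rightarrow> nat" where
    w: "\<forall>m\<in>Poly_Mapping.lookup ` K. \<forall>m'\<in>Poly_Mapping.lookup ` K.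
           (\<Sum>a\<in>L. m a * w a) = (\<Sum>a\<in>L. m' a * w a) \<longrightarrow> (\<forall>a\<in>L. m a = m' a)"
    using separating_weights[OF assms(1), of "Poly_Mapping.lookup ` K"] finK by blast
  define e where "e = (\<lambda>m. \<Sum>a\<in>L. Poly_Mapping.lookup m a * w a)"
  have inj: "inj_on e K"
  proof (rule inj_onI)
    fix m m' assume m: "m \<in> K" "m' \<in> K" and "e m = e m'"
    then have L: "\<forall>a\<in>L. Poly_Mapping.lookup m a = Poly_Mapping.lookup m' a"
      using w[rule_format, OF imageI imageI, OF m] unfolding e_def by blast
    show "m = m'"
    proof (rule poly_mapping_eqI)
      fix a
      show "Poly_Mapping.lookup m a = Poly_Mapping.lookup m' a"
      proof (cases "a \<in> L")
        case True
        with L show ?thesis by blast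
      next
        case False
        then have "a \<notin> Poly_Mapping.keys m" "a \<notin> Poly_Mapping.keys m'"
          using KL[OF m(1)] KL[OF m(2)] by blast+
        then show ?thesis by (simp add: in_keys_iff)
      qed
    qed
  qed
  define F where "F = (\<lambda>h :: 'v cpoly. \<Sum>m\<in>Poly_Mapping.keys h.
                          monom (Poly_Mapping.lookup h m) (e m))"
  have nz: "F h \<noteq> 0" if h: "Poly_Mapping.keys h \<subseteq> K" "h \<noteq> 0" for h
  proof -
    from h(2) obtain m0 where m0: "m0 \<in> Poly_Mapping.keys h"
      by (metis equals0I keys_eq_empty)
    have "coeff (F h) (e m0) =
            (\<Sum>m\<in>Poly_Mapping.keys h. if m = m0 then Poly_Mapping.lookup h m else 0)"
      unfolding F_def coeff_sum using m0 h(1)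
      by (intro sum.cong) (auto dest: inj_onD[OF inj])
    also have "\<dots> = Poly_Mapping.lookup h m0" using m0 by simp
    also have "\<dots> \<noteq> 0" using m0 by (simp add: in_keys_iff)
    finally show ?thesis by auto
  qed
  have ev: "eval_cpoly h (\<lambda>a. of_nat (t ^ w a)) = poly (F h) (of_nat t)"
    if h: "Poly_Mapping.keys h \<subseteq> K" for h t
  proof -
    have "(\<Prod>v\<in>Poly_Mapping.keys m. complex_of_nat (t ^ w v) ^ Poly_Mapping.lookup m v) =
            of_nat t ^ e m" if "m \<in> Poly_Mapping.keys h" for m
    proof -
      have "(\<Prod>v\<in>Poly_Mapping.keys m. complex_of_nat (t ^ w v) ^ Poly_Mapping.lookup m v) =
            (\<Prod>v\<in>L. complex_of_nat (t ^ w v) ^ Poly_Mapping.lookup m v)"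
        using KL[OF subsetD[OF h that]] assms(1)
        by (intro prod.mono_neutral_left) (simp_all add: in_keys_iff)
      also have "\<dots> = of_nat t ^ e m"
        unfolding e_def power_sum of_nat_power by (intro prod.cong) (simp_all add: power_mult mult.commute[of _ "w _"])
      finally show ?thesis .
    qed
    then show ?thesis
      by (simp add: eval_cpoly_def F_def poly_sum poly_monom)
  qed
  have ff: "F f \<noteq> 0" "F g \<noteq> 0"
    using nz[of f] nz[of g] assms(4,5) unfolding K_def by blast+
  then have "finite {x. poly (F f * F g) x = 0}"
    by (intro poly_roots_finite) simp
  then have "finite (of_nat -` {x. poly (F f * F g) x = 0} :: nat set)"
    by (intro finite_vimageI) (auto intro: inj_of_nat)
  then have "finite (insert 0 (of_nat -` {x. poly (F f * F g) x = 0} :: nat set))"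
    by simp
  then obtain t :: nat where "t \<notin> insert 0 (of_nat -` {x. poly (F f * F g) x = 0})"
    using ex_new_if_finite infinite_UNIV_nat by blast
  then have "t > 0" "poly (F f) (of_nat t) \<noteq> 0" "poly (F g) (of_nat t) \<noteq> 0"
    by auto
  then show ?thesis
    using ev[of f t] ev[of g t] by (intro exI[of _ "\<lambda>a. t ^ w a"]) (auto simp: K_def)
qed

lemma has_ML_degree_unique:
  assumes "finite (lattice_points P)" "lattice_points P \<noteq> {}"
    and "has_ML_degree P k" "has_ML_degree P l"
  shows "k = l"
proof -
  obtain f g where fg: "f \<in> cpolys (lattice_points P)" "g \<in> cpolys (lattice_points P)"
      "f \<noteq> 0" "g \<noteq> 0"
    and f: "\<And>u. data_total P u > 0 \<Longrightarrow> eval_cpoly f (\<lambda>a. of_nat (u a)) \<noteq> 0 \<Longrightarrow>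
              card (score_solutions P u) = k"
    and g: "\<And>u. data_total P u > 0 \<Longrightarrow> eval_cpoly g (\<lambda>a. of_nat (u a)) \<noteq> 0 \<Longrightarrow>
              card (score_solutions P u) = l"
    using assms(3,4) unfolding has_ML_degree_def by blast
  obtain u where u: "\<forall>a. u a > 0" "eval_cpoly f (\<lambda>a. of_nat (u a)) \<noteq> 0"
      "eval_cpoly g (\<lambda>a. of_nat (u a)) \<noteq> 0"
    using generic_nat_point[OF assms(1) fg] by blast
  have "data_total P u > 0"
    unfolding data_total_def using assms(1,2) u(1) by (intro sum_pos) auto
  with f g u show ?thesis by metis
qed

end

theory Submission
  imports Defs
begin

text \<open>
  The lattice points of the cube are \<open>{-1, 0, 1}\<^sup>d\<close>.  They contain the origin and the unit
  vectors, so the points of \<open>V\<close> with nonzero coordinates are exactly the points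
  \<open>p\<^sub>a = s \<theta>\<^sup>a\<close>, and \<open>(s, \<theta>)\<close> can be read off from \<open>p\<close>
  (\<open>toric_variety_torus_points\<close>).  Counting solutions of the score equations therefore means
  counting parameters.

  Since the lattice points form a product, so do the sums in the score equations: with
  \<open>\<sigma>(t) = 1/t + 1 + t\<close> they read \<open>s \<Prod>\<^sub>j \<sigma>(\<theta>\<^sub>j) = 1\<close> and
  \<open>s (\<theta>\<^sub>i - 1/\<theta>\<^sub>i) \<Prod>\<^sub>j\<^sub>\<noteq>\<^sub>i \<sigma>(\<theta>\<^sub>j) = b\<^sub>i\<close>, where \<open>b\<^sub>i\<close> is the mean of the
  \<open>i\<close>-th coordinate in the data.  Dividing by the first equation decouples the system: \<open>s\<close> is
  determined by \<open>\<theta>\<close>, and each \<open>\<theta>\<^sub>i\<close> has to satisfy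
  \<open>\<theta>\<^sub>i - 1/\<theta>\<^sub>i = b\<^sub>i \<sigma>(\<theta>\<^sub>i)\<close> (\<open>cube_score_equations_iff\<close>), the score equation of a single
  segment.  This is a quadratic equation with discriminant \<open>4 - 3 b\<^sub>i\<^sup>2\<close>, and it has exactly two
  nonzero roots when \<open>\<bar>b\<^sub>i\<bar> < 1\<close> (\<open>card_segment_solutions\<close>).  The mean \<open>b\<^sub>i\<close> lies strictly
  between \<open>-1\<close> and \<open>1\<close> as soon as the origin is observed at all (\<open>abs_data_mean_less_1\<close>).
  The two choices for each of the \<open>d\<close> parameters \<open>\<theta>\<^sub>i\<close> give \<open>2\<^sup>d\<close> solutions.
\<close>

section \<open>Evaluation of polynomials\<close>

definition eval_monom :: "('v \<Rightarrow>\<^sub>0 nat) \<Rightarrow> ('v \<Rightarrow> complex) \<Rightarrow> complex" where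
  "eval_monom m x = (\<Prod>v\<in>Poly_Mapping.keys m. x v ^ Poly_Mapping.lookup m v)"

lemma eval_monom_superset:
  assumes "finite K" "Poly_Mapping.keys m \<subseteq> K"
  shows "eval_monom m x = (\<Prod>v\<in>K. x v ^ Poly_Mapping.lookup m v)"
  unfolding eval_monom_def using assms
  by (intro prod.mono_neutral_left) (auto simp: in_keys_iff)

lemma eval_monom_zero [simp]: "eval_monom 0 x = 1"
  by (simp add: eval_monom_def)

lemma eval_monom_single [simp]: "eval_monom (Poly_Mapping.single v k) x = x v ^ k"
  by (subst eval_monom_superset[of "{v}"]) auto

lemma eval_monom_add [simp]: "eval_monom (m + m') x = eval_monom m x * eval_monom m' x"
proof -
  let ?K = "Poly_Mapping.keys m \<union> Poly_Mapping.keys m'"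
  have "Poly_Mapping.keys (m + m') \<subseteq> ?K" by (rule Poly_Mapping.keys_add)
  then show ?thesis
    by (simp add: eval_monom_superset[of ?K] lookup_add power_add prod.distrib)
qed

lemma eval_monom_sum [simp]: "eval_monom (\<Sum>i\<in>I. m i) x = (\<Prod>i\<in>I. eval_monom (m i) x)"
  by (induction I rule: infinite_finite_induct) auto

lemma eval_cpoly_superset:
  assumes "finite K" "Poly_Mapping.keys f \<subseteq> K"
  shows "eval_cpoly f x = (\<Sum>m\<in>K. Poly_Mapping.lookup f m * eval_monom m x)"
  unfolding eval_cpoly_def eval_monom_def[symmetric] using assms
  by (intro sum.mono_neutral_left) (auto simp: in_keys_iff)

lemma eval_cpoly_single [simp]: "eval_cpoly (Poly_Mapping.single m c) x = c * eval_monom m x"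
  by (subst eval_cpoly_superset[of "{m}"]) auto

lemma eval_cpoly_diff [simp]: "eval_cpoly (f - g) x = eval_cpoly f x - eval_cpoly g x"
proof -
  let ?K = "Poly_Mapping.keys f \<union> Poly_Mapping.keys g"
  have "Poly_Mapping.keys (f - g) \<subseteq> ?K" by (rule keys_diff)
  then show ?thesis
    by (simp add: eval_cpoly_superset[of ?K] lookup_minus left_diff_distrib sum_subtractf)
qed

lemma binomial_in_cpolys:
  assumes "Poly_Mapping.keys m \<subseteq> L" "Poly_Mapping.keys m' \<subseteq> L"
  shows "Poly_Mapping.single m 1 - Poly_Mapping.single m' 1 \<in> cpolys L"
  using assms keys_diff[of "Poly_Mapping.single m (1::complex)" "Poly_Mapping.single m' 1"]
  by (fastforce simp: cpolys_def split: if_splits)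

section \<open>The points of the toric variety in the torus\<close>

lemma zariski_closure_superset:
  assumes "S \<subseteq> L \<rightarrow>\<^sub>E UNIV"
  shows "S \<subseteq> zariski_closure L S"
  using assms by (auto simp: zariski_closure_def)

text \<open>
  An equation between monomials that holds on a set is a binomial vanishing on it, so it
  persists on the closure.
\<close>

lemma zariski_closure_binomial:
  assumes "x \<in> zariski_closure L S"
    and "Poly_Mapping.keys m \<subseteq> L" "Poly_Mapping.keys m' \<subseteq> L"
    and "\<And>y. y \<in> S \<Longrightarrow> eval_monom m y = eval_monom m' y"
  shows "eval_monom m x = eval_monom m' x"
proof -
  have "eval_cpoly (Poly_Mapping.single m 1 - Poly_Mapping.single m' 1) x = 0"
    using assms(1) binomial_in_cpolys[OF assms(2,3)] assms(4)
    by (auto simp: zariski_closure_def)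
  then show ?thesis by simp
qed

lemma monomial_map_nonzero:
  assumes "s \<noteq> 0" "\<forall>i. \<theta> $ i \<noteq> 0"
  shows "monomial_map L s \<theta> \<in> L \<rightarrow>\<^sub>E (- {0})"
  using assms by (auto simp: monomial_map_def)

lemma monomial_map_zero: "0 \<in> L \<Longrightarrow> monomial_map L s \<theta> 0 = s"
  by (simp add: monomial_map_def design_matrix_def)

lemma monomial_map_axis:
  assumes "axis i 1 \<in> L"
  shows "monomial_map L s \<theta> (axis i 1) = s * \<theta> $ i"
proof -
  have "(\<Prod>j\<in>UNIV. \<theta> $ j powi (axis i 1 $ j)) = (\<Prod>j\<in>UNIV. if j = i then \<theta> $ j else 1)"
    by (intro prod.cong) (auto simp: axis_def)
  then show ?thesis using assms by (simp add: monomial_map_def design_matrix_def)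
qed

lemma power_int_mult_nat_neg:
  assumes "(t::complex) \<noteq> 0"
  shows "t powi k * t ^ nat (- k) = t ^ nat k"
  using assms by (cases "k \<ge> 0") (auto simp: power_int_def field_simps)

text \<open>
  If the lattice points contain the origin and the unit vectors, a point \<open>p\<close> of the torus
  determines its only possible parameters \<open>s = p\<^sub>0\<close> and \<open>\<theta>\<^sub>i = p(e\<^sub>i) / p\<^sub>0\<close>.  That
  these parameters really produce \<open>p\<close> is the content of the binomial equations of \<open>V\<close>
  attached to the relations expressing each lattice point by \<open>0\<close> and the \<open>e\<^sub>i\<close>.  Hence
  passing to the closure adds no points inside the torus.
\<close>

lemma toric_variety_torus_points:
  fixes P :: "(real^'d) set"
  defines "L \<equiv> lattice_points P"
  assumes zero: "0 \<in> L" and unit: "\<And>i. axis i 1 \<in> L"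
  shows "toric_variety P \<inter> (L \<rightarrow>\<^sub>E (- {0})) =
           {monomial_map L s \<theta> | s \<theta>. s \<noteq> 0 \<and> (\<forall>i. \<theta> $ i \<noteq> 0)}"
    (is "_ = ?S")
proof
  have S: "?S \<subseteq> L \<rightarrow>\<^sub>E (- {0})"
    using monomial_map_nonzero by blast
  also have "\<dots> \<subseteq> L \<rightarrow>\<^sub>E UNIV" by (rule PiE_mono) simp
  finally have "?S \<subseteq> L \<rightarrow>\<^sub>E UNIV" .
  from zariski_closure_superset[OF this] S
  show "?S \<subseteq> toric_variety P \<inter> (L \<rightarrow>\<^sub>E (- {0}))"
    unfolding toric_variety_def L_def by blast
next
  show "toric_variety P \<inter> (L \<rightarrow>\<^sub>E (- {0})) \<subseteq> ?S"
  proof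
    fix p assume p: "p \<in> toric_variety P \<inter> (L \<rightarrow>\<^sub>E (- {0}))"
    then have cl: "p \<in> zariski_closure L ?S"
      by (simp add: toric_variety_def L_def)
    have nz: "p a \<noteq> 0" if "a \<in> L" for a using p that by auto
    define s where "s = p 0"
    define \<theta> where "\<theta> = (\<chi> i. p (axis i 1) / p 0)"
    have s: "s \<noteq> 0" using nz[OF zero] by (simp add: s_def)
    have \<theta>: "\<theta> $ i \<noteq> 0" for i using nz[OF zero] nz[OF unit] by (simp add: \<theta>_def)
    have axis: "p (axis i 1) = s * \<theta> $ i" for i
      using nz[OF zero] by (simp add: s_def \<theta>_def)
    have coord: "p a = s * (\<Prod>i\<in>UNIV. \<theta> $ i powi (a $ i))" if a: "a \<in> L" for a
    proof -
      (* The relation a + sum (-a_i)^+ e_i = sum (a_i)^+ e_i between lattice points; multiples of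
         the lattice point 0 make both monomials of the same degree, so that s cancels. *)
      define m where "m = Poly_Mapping.single a 1 +
        (\<Sum>i\<in>UNIV. Poly_Mapping.single 0 (nat (a $ i)) + Poly_Mapping.single (axis i 1) (nat (- (a $ i))))"
      define m' where "m' = Poly_Mapping.single 0 1 +
        (\<Sum>i\<in>UNIV. Poly_Mapping.single (axis i 1) (nat (a $ i)) + Poly_Mapping.single (0::int^'d) (nat (- (a $ i))))"
      have keys: "Poly_Mapping.keys m \<subseteq> L" "Poly_Mapping.keys m' \<subseteq> L"
        unfolding m_def m'_def using a zero unit
        by (auto dest!: subsetD[OF Poly_Mapping.keys_add] subsetD[OF Poly_Mapping.keys_sum]
            split: if_splits)
      have ev: "eval_monom m y = y a * (\<Prod>i\<in>UNIV. y 0 ^ nat (a $ i) * y (axis i 1) ^ nat (- (a $ i)))"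
        "eval_monom m' y = y 0 * (\<Prod>i\<in>UNIV. y (axis i 1) ^ nat (a $ i) * y 0 ^ nat (- (a $ i)))" for y
        by (simp_all add: m_def m'_def)
      have param: "y 0 * (\<Prod>i\<in>UNIV. t $ i powi (a $ i)) *
             (\<Prod>i\<in>UNIV. y 0 ^ nat (a $ i) * y (axis i 1) ^ nat (- (a $ i))) = eval_monom m' y"
        if t: "\<And>i. t $ i \<noteq> 0" and y: "\<And>i. y (axis i 1) = y 0 * t $ i"
        for y :: "int^'d \<Rightarrow> complex" and t :: "complex^'d"
      proof -
        have "t $ i powi (a $ i) * (y 0 ^ nat (a $ i) * y (axis i 1) ^ nat (- (a $ i))) =
            y (axis i 1) ^ nat (a $ i) * y 0 ^ nat (- (a $ i))" for i
          by (simp add: y power_mult_distrib power_int_mult_nat_neg[OF t[of i], of "a $ i", symmetric] mult_ac)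
        then show ?thesis
          by (simp add: ev(2) mult.assoc flip: prod.distrib)
      qed
      have A: "eval_monom m p = eval_monom m' p"
      proof (rule zariski_closure_binomial[OF cl keys])
        fix y assume "y \<in> ?S"
        then obtain r t where r: "r \<noteq> 0" and t: "\<And>i. t $ i \<noteq> 0" and y: "y = monomial_map L r t"
          by blast
        have "y a = y 0 * (\<Prod>i\<in>UNIV. t $ i powi (a $ i))"
          using a zero by (simp add: y monomial_map_zero)
            (simp add: monomial_map_def design_matrix_def)
        moreover have "y (axis i 1) = y 0 * t $ i" for i
          using zero unit by (simp add: y monomial_map_zero monomial_map_axis)
        ultimately show "eval_monom m y = eval_monom m' y"
          using param[of t y] t by (simp add: ev(1))
      qed
      have B: "s * (\<Prod>i\<in>UNIV. \<theta> $ i powi (a $ i)) *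
             (\<Prod>i\<in>UNIV. p 0 ^ nat (a $ i) * p (axis i 1) ^ nat (- (a $ i))) = eval_monom m' p"
        using param[of \<theta> p] \<theta> axis by (simp add: s_def)
      have C: "(\<Prod>i\<in>UNIV. p 0 ^ nat (a $ i) * p (axis i 1) ^ nat (- (a $ i))) \<noteq> 0"
        using nz[OF zero] nz[OF unit] by auto
      from mult_right_cancel[OF C] show ?thesis
        using trans[OF A B[symmetric]] unfolding ev(1) by blast
    qed
    have "p = monomial_map L s \<theta>"
    proof
      fix a show "p a = monomial_map L s \<theta> a"
        using coord[of a] p by (cases "a \<in> L") (auto simp: monomial_map_def design_matrix_def)
    qed
    then show "p \<in> ?S" using s \<theta> by blast
  qed
qed

section \<open>Boxes in coordinate spaces\<close>

lemma bij_betw_vec_PiE: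
  "bij_betw (\<lambda>x. vec_nth x) {x :: 'a^'d. \<forall>i. x $ i \<in> B i} (PiE UNIV B)"
  by (rule bij_betwI[where g = vec_lambda]) (auto simp: PiE_def)

lemma card_vec_box:
  "card {x :: 'a^'d. \<forall>i. x $ i \<in> B i} = (\<Prod>i\<in>UNIV. card (B i))"
  using bij_betw_same_card[OF bij_betw_vec_PiE[of B]] by (simp add: card_PiE)

lemma finite_vec_box:
  assumes "\<And>i. finite (B i)"
  shows "finite {x :: 'a^'d. \<forall>i. x $ i \<in> B i}"
  using bij_betw_finite[OF bij_betw_vec_PiE[of B]] assms by (simp add: finite_PiE)

lemma sum_vec_box_prod:
  fixes g :: "'d::finite \<Rightarrow> 'a \<Rightarrow> 'b::comm_semiring_1"
  assumes "\<And>i. finite (B i)"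
  shows "(\<Sum>x\<in>{x :: 'a^'d. \<forall>i. x $ i \<in> B i}. \<Prod>i\<in>UNIV. g i (x $ i)) =
           (\<Prod>i\<in>UNIV. \<Sum>k\<in>B i. g i k)"
  using assms
  by (simp add: prod_sum_PiE sum.reindex_bij_betw[OF bij_betw_vec_PiE, where g = "\<lambda>h. \<Prod>i\<in>UNIV. g i (h i)", symmetric])

section \<open>The score equations of the cube\<close>

lemma lattice_points_cube:
  "lattice_points (cube :: (real^'d) set) = {a. \<forall>i. a $ i \<in> {-1, 0, 1}}"
proof -
  have "real_of_int k \<in> {-1..1} \<longleftrightarrow> k \<in> {-1, 0, 1}" for k by auto
  then show ?thesis by (simp add: lattice_points_def cube_def del: atLeastAtMost_iff insert_iff)
qed

lemma zero_in_lattice_points_cube: "0 \<in> lattice_points (cube :: (real^'d) set)"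
  by (simp add: lattice_points_cube)

lemma axis_in_lattice_points_cube: "axis i 1 \<in> lattice_points (cube :: (real^'d) set)"
  by (simp add: lattice_points_cube axis_def)

lemma finite_lattice_points_cube: "finite (lattice_points (cube :: (real^'d) set))"
  unfolding lattice_points_cube by (rule finite_vec_box) simp

text \<open>The sum of the monomials at the lattice points of the segment \<open>[-1, 1]\<close>.\<close>

definition segment_sum :: "complex \<Rightarrow> complex" where
  "segment_sum t = inverse t + 1 + t"

lemma cube_sum_monomial_map:
  "(\<Sum>a\<in>lattice_points cube. monomial_map (lattice_points cube) s \<theta> a) =
     s * (\<Prod>j\<in>UNIV. segment_sum (\<theta> $ j))"
  unfolding lattice_points_cube
  by (simp add: monomial_map_def design_matrix_def flip: sum_distrib_left)
    (subst sum_vec_box_prod[where B = "\<lambda>_. {-1, 0, 1}", simplified],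
     simp_all add: segment_sum_def power_int_minus add.assoc)

text \<open>
  Weighting by the \<open>i\<close>-th coordinate is absorbed into the \<open>i\<close>-th factor of each monomial, so
  only the \<open>i\<close>-th factor of the product changes.
\<close>

lemma cube_moment_monomial_map:
  "(\<Sum>a\<in>lattice_points cube. of_int (a $ i) * monomial_map (lattice_points cube) s \<theta> a) =
     s * ((\<theta> $ i - inverse (\<theta> $ i)) * (\<Prod>j\<in>UNIV - {i}. segment_sum (\<theta> $ j)))"
proof -
  define g where "g = (\<lambda>j (k::int). (if j = i then of_int k else 1) * (\<theta> $ j) powi k)"
  have "(\<Prod>j\<in>UNIV. g j (a $ j)) = of_int (a $ i) * (\<Prod>j\<in>UNIV. (\<theta> $ j) powi (a $ j))" for a :: "int^'a"
    by (simp add: g_def prod.distrib)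
  then have "(\<Sum>a\<in>lattice_points cube. of_int (a $ i) * monomial_map (lattice_points cube) s \<theta> a) =
      (\<Sum>a\<in>lattice_points cube. s * (\<Prod>j\<in>UNIV. g j (a $ j)))"
    by (intro sum.cong) (auto simp: monomial_map_def design_matrix_def)
  also have "\<dots> = s * (\<Prod>j\<in>UNIV. \<Sum>k\<in>{-1, 0, 1}. g j k)"
    unfolding lattice_points_cube sum_distrib_left[symmetric]
    by (subst sum_vec_box_prod) auto
  also have "(\<Prod>j\<in>UNIV. \<Sum>k\<in>{-1, 0, 1}. g j k) =
      (\<Sum>k\<in>{-1, 0, 1}. g i k) * (\<Prod>j\<in>UNIV - {i}. \<Sum>k\<in>{-1, 0, 1}. g j k)"
    by (rule prod.remove) auto
  also have "(\<Sum>k\<in>{-1, 0, 1}. g i k) = \<theta> $ i - inverse (\<theta> $ i)"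
    by (simp add: g_def power_int_minus)
  also have "(\<Prod>j\<in>UNIV - {i}. \<Sum>k\<in>{-1, 0, 1}. g j k) = (\<Prod>j\<in>UNIV - {i}. segment_sum (\<theta> $ j))"
    by (intro prod.cong) (auto simp: g_def segment_sum_def power_int_minus)
  finally show ?thesis .
qed

text \<open>
  The score equation of the one-dimensional cube, after elimination of \<open>s\<close>.
\<close>

definition segment_solutions :: "complex \<Rightarrow> complex set" where
  "segment_solutions b = {t. t \<noteq> 0 \<and> t - inverse t = b * segment_sum t}"

text \<open>
  Where \<open>1 + t + t\<^sup>2\<close> vanishes, the equation would force \<open>t\<^sup>2 = 1\<close>, which is impossible for a
  primitive cube root of unity.
\<close>

lemma segment_sum_nonzero:
  assumes "t \<in> segment_solutions b"
  shows "segment_sum t \<noteq> 0"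
proof
  assume 0: "segment_sum t = 0"
  have t: "t \<noteq> 0" "t = inverse t"
    using assms 0 by (auto simp: segment_solutions_def)
  then have "t * t = 1" by (metis right_inverse)
  then have "t = 1 \<or> t = -1" by (simp add: square_eq_1_iff)
  with 0 show False by (auto simp: segment_sum_def)
qed

text \<open>
  Clearing denominators leaves \<open>(1 - b) t\<^sup>2 - b t - (1 + b) = 0\<close>, whose discriminant is
  \<open>4 - 3 b\<^sup>2\<close>.  For \<open>\<bar>b\<bar> < 1\<close> the leading and constant coefficients and the
  discriminant are all nonzero.
\<close>

lemma card_segment_solutions:
  fixes b :: real
  assumes "\<bar>b\<bar> < 1"
  shows "card (segment_solutions (of_real b)) = 2"
proof -
  define r where "r = sqrt (4 - 3 * b\<^sup>2)"
  have "b\<^sup>2 < 1" using assms by (simp add: abs_square_less_1)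
  then have r: "r > 0" "r\<^sup>2 = 4 - 3 * b\<^sup>2" by (simp_all add: r_def)
  define c where "c = complex_of_real b"
  define q where "q = complex_of_real r"
  have q: "q \<noteq> 0" "q\<^sup>2 = 4 - 3 * c\<^sup>2"
    using r(1) arg_cong[OF r(2), of complex_of_real] by (simp_all add: q_def c_def)
  have c: "1 - c \<noteq> 0" "1 + c \<noteq> 0"
  proof -
    have "1 - c = of_real (1 - b)" "1 + c = of_real (1 + b)" by (simp_all add: c_def)
    then show "1 - c \<noteq> 0" "1 + c \<noteq> 0" using assms by (simp_all only: of_real_eq_0_iff)
  qed
  have "t \<in> segment_solutions c \<longleftrightarrow> (1 - c) * t\<^sup>2 - c * t - (1 + c) = 0" for t
  proof (cases "t = 0")
    case True
    with c(2) show ?thesis by (simp add: segment_solutions_def del: add_eq_0_iff) (metis add.right_inverse)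
  next
    case False
    have "t - inverse t - c * segment_sum t = ((1 - c) * t\<^sup>2 - c * t - (1 + c)) / t"
      using False by (simp add: segment_sum_def field_simps power2_eq_square)
    then show ?thesis using False
      by (simp add: segment_solutions_def) (metis divide_eq_0_iff eq_iff_diff_eq_0)
  qed
  also have "((1 - c) * t\<^sup>2 - c * t - (1 + c) = 0) \<longleftrightarrow> t = (c + q) / (2 * (1 - c)) \<or> t = (c - q) / (2 * (1 - c))" for t
  proof -
    (* completing the square *)
    have "4 * (1 - c) * ((1 - c) * t\<^sup>2 - c * t - (1 + c)) = (2 * (1 - c) * t - c)\<^sup>2 - q\<^sup>2"
      unfolding q(2) by (simp add: algebra_simps power2_eq_square)
    also have "\<dots> = (t * (2 * (1 - c)) - (c + q)) * (t * (2 * (1 - c)) - (c - q))"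
      by (simp add: algebra_simps power2_eq_square)
    finally have "(1 - c) * t\<^sup>2 - c * t - (1 + c) = 0 \<longleftrightarrow>
        t * (2 * (1 - c)) = c + q \<or> t * (2 * (1 - c)) = c - q"
      using c by (metis eq_iff_diff_eq_0 mult_eq_0_iff zero_neq_numeral)
    then show ?thesis using c by (simp add: eq_divide_eq)
  qed
  finally have "segment_solutions c = {(c + q) / (2 * (1 - c)), (c - q) / (2 * (1 - c))}" by blast
  moreover have "(c + q) / (2 * (1 - c)) \<noteq> (c - q) / (2 * (1 - c))"
    using c q(1) by (simp add: divide_cancel_right)
  ultimately show ?thesis by (simp add: c_def)
qed

text \<open>
  The right-hand side of the \<open>i\<close>-th score equation, taken in the reals so that it can be
  compared with \<open>1\<close>.
\<close>

definition data_mean :: "(int^'d \<Rightarrow> nat) \<Rightarrow> 'd \<Rightarrow> real" where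
  "data_mean u i = (\<Sum>a\<in>lattice_points cube. of_int (a $ i) * of_nat (u a)) / of_nat (data_total cube u)"

text \<open>
  The mean is a weighted average of numbers in \<open>[-1, 1]\<close>, and the origin enters it with
  positive weight.
\<close>

lemma abs_data_mean_less_1:
  fixes u :: "int^'d \<Rightarrow> nat"
  assumes "u 0 > 0"
  shows "\<bar>data_mean u i\<bar> < 1"
proof -
  let ?L = "lattice_points (cube :: (real^'d) set)"
  have "\<bar>\<Sum>a\<in>?L. real_of_int (a $ i) * real (u a)\<bar> \<le> (\<Sum>a\<in>?L. \<bar>real_of_int (a $ i) * real (u a)\<bar>)"
    by (rule sum_abs)
  also have "\<dots> < (\<Sum>a\<in>?L. real (u a))"
  proof (rule sum_strict_mono_ex1[OF finite_lattice_points_cube])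
    show "\<forall>a\<in>?L. \<bar>real_of_int (a $ i) * real (u a)\<bar> \<le> real (u a)"
    proof
      fix a assume "a \<in> ?L"
      then have "a $ i \<in> {-1, 0, 1}" by (simp only: lattice_points_cube mem_Collect_eq)
      then show "\<bar>real_of_int (a $ i) * real (u a)\<bar> \<le> real (u a)" by auto
    qed
    show "\<exists>a\<in>?L. \<bar>real_of_int (a $ i) * real (u a)\<bar> < real (u a)"
      using zero_in_lattice_points_cube assms by (intro bexI[of _ 0]) auto
  qed
  finally show ?thesis
    by (auto simp: data_mean_def data_total_def abs_divide divide_less_eq_1)
qed

text \<open>
  Here the \<open>d\<close>-dimensional system decouples.  The row of ones says
  \<open>s = 1 / (\<Prod>\<^sub>j segment_sum \<theta>\<^sub>j)\<close>, and dividing the \<open>i\<close>-th equation by it leaves an equation in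
  \<open>\<theta>\<^sub>i\<close> alone.
\<close>

lemma cube_score_equations_iff:
  fixes \<theta> :: "complex^'d" and b :: "'d \<Rightarrow> complex"
  assumes "\<forall>i. \<theta> $ i \<noteq> 0"
  shows "s * (\<Prod>j\<in>UNIV. segment_sum (\<theta> $ j)) = 1 \<and>
      (\<forall>i. s * ((\<theta> $ i - inverse (\<theta> $ i)) * (\<Prod>j\<in>UNIV - {i}. segment_sum (\<theta> $ j))) = b i) \<longleftrightarrow>
    s = 1 / (\<Prod>j\<in>UNIV. segment_sum (\<theta> $ j)) \<and> (\<forall>i. \<theta> $ i \<in> segment_solutions (b i))"
proof -
  define Q where "Q = (\<lambda>i. \<Prod>j\<in>UNIV - {i}. segment_sum (\<theta> $ j))"
  have Q: "(\<Prod>j\<in>UNIV. segment_sum (\<theta> $ j)) = segment_sum (\<theta> $ i) * Q i" for i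
    unfolding Q_def by (rule prod.remove) auto
  let ?\<Pi> = "\<Prod>j\<in>UNIV. segment_sum (\<theta> $ j)"
  have *: "s * ((\<theta> $ i - inverse (\<theta> $ i)) * Q i) = b i \<longleftrightarrow> \<theta> $ i \<in> segment_solutions (b i)"
    if "s * ?\<Pi> = 1" for i
  proof -
    have "s * Q i \<noteq> 0" "b i = b i * segment_sum (\<theta> $ i) * (s * Q i)"
      using that unfolding Q[of i] by (auto simp: algebra_simps)
    then have "s * ((\<theta> $ i - inverse (\<theta> $ i)) * Q i) = b i \<longleftrightarrow>
        (\<theta> $ i - inverse (\<theta> $ i)) * (s * Q i) = b i * segment_sum (\<theta> $ i) * (s * Q i)"
      by (simp only: mult.left_commute[of s])
    also have "\<dots> \<longleftrightarrow> \<theta> $ i - inverse (\<theta> $ i) = b i * segment_sum (\<theta> $ i)"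
      using \<open>s * Q i \<noteq> 0\<close> by (rule mult_right_cancel)
    finally show ?thesis using assms by (simp add: segment_solutions_def)
  qed
  have s: "s * ?\<Pi> = 1 \<longleftrightarrow> s = 1 / ?\<Pi>" if "?\<Pi> \<noteq> 0"
    using that by (simp add: eq_divide_eq)
  show ?thesis
  proof (cases "?\<Pi> = 0")
    case True
    then have "\<not> (\<forall>i. \<theta> $ i \<in> segment_solutions (b i))"
      using segment_sum_nonzero by fastforce
    moreover have "s * ?\<Pi> \<noteq> 1" using True by (simp only: mult_zero_right) simp
    ultimately show ?thesis by blast
  next
    case False
    then show ?thesis using * s unfolding Q_def by blast
  qed
qed

text \<open>The normalisation \<open>s\<close> is the one that makes the coordinates of the point sum to \<open>1\<close>.\<close>

definition cube_point :: "complex^'d \<Rightarrow> int^'d \<Rightarrow> complex" where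
  "cube_point \<theta> = monomial_map (lattice_points cube) (1 / (\<Prod>j\<in>UNIV. segment_sum (\<theta> $ j))) \<theta>"

lemma score_solutions_cube:
  fixes u :: "int^'d \<Rightarrow> nat"
  assumes "data_total cube u > 0"
  shows "score_solutions cube u =
    cube_point ` {\<theta>. \<forall>i. \<theta> $ i \<in> segment_solutions (of_real (data_mean u i))}"
    (is "_ = cube_point ` ?T")
proof -
  let ?L = "lattice_points (cube :: (real^'d) set)"
  let ?N = "complex_of_nat (data_total cube u)"
  have N: "?N \<noteq> 0" using assms by simp
  define score where "score p \<longleftrightarrow> (\<forall>r. (\<Sum>a\<in>?L. of_int (ext_design_matrix r a) * p a) =
      1 / ?N * (\<Sum>a\<in>?L. of_int (ext_design_matrix r a) * of_nat (u a)))" for p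
  have "score p \<longleftrightarrow> (\<Sum>a\<in>?L. p a) = 1 \<and>
      (\<forall>i. (\<Sum>a\<in>?L. of_int (a $ i) * p a) = of_real (data_mean u i))" for p
    unfolding score_def split_option_all using N
    by (simp add: ext_design_matrix_def design_matrix_def data_mean_def data_total_def)
  then have score: "score (monomial_map ?L s \<theta>) \<longleftrightarrow>
      s = 1 / (\<Prod>j\<in>UNIV. segment_sum (\<theta> $ j)) \<and> \<theta> \<in> ?T"
    if "\<forall>i. \<theta> $ i \<noteq> 0" for s \<theta>
    using cube_score_equations_iff[OF that, of s "\<lambda>i. of_real (data_mean u i)"]
    by (simp add: cube_sum_monomial_map cube_moment_monomial_map)
  have T: "(\<forall>i. \<theta> $ i \<noteq> 0) \<and> (\<Prod>j\<in>UNIV. segment_sum (\<theta> $ j)) \<noteq> 0" if "\<theta> \<in> ?T" for \<theta>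
    using that segment_sum_nonzero by (fastforce simp: segment_solutions_def)
  have "score_solutions cube u =
      {p \<in> {monomial_map ?L s \<theta> | s \<theta>. s \<noteq> 0 \<and> (\<forall>i. \<theta> $ i \<noteq> 0)}. score p}"
    using toric_variety_torus_points[of "cube :: (real^'d) set",
        OF zero_in_lattice_points_cube axis_in_lattice_points_cube]
    by (simp add: score_solutions_def score_def)
  also have "\<dots> = cube_point ` ?T"
  proof
    show "{p \<in> {monomial_map ?L s \<theta> | s \<theta>. s \<noteq> 0 \<and> (\<forall>i. \<theta> $ i \<noteq> 0)}. score p} \<subseteq> cube_point ` ?T"
    proof
      fix p assume "p \<in> {p \<in> {monomial_map ?L s \<theta> | s \<theta>. s \<noteq> 0 \<and> (\<forall>i. \<theta> $ i \<noteq> 0)}. score p}"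
      then obtain s \<theta> where p: "p = monomial_map ?L s \<theta>" "\<forall>i. \<theta> $ i \<noteq> 0" "score p"
        by blast
      then have "p = cube_point \<theta>" "\<theta> \<in> ?T"
        using score[OF p(2), of s] by (simp_all add: cube_point_def)
      then show "p \<in> cube_point ` ?T" by (rule image_eqI)
    qed
    show "cube_point ` ?T \<subseteq> {p \<in> {monomial_map ?L s \<theta> | s \<theta>. s \<noteq> 0 \<and> (\<forall>i. \<theta> $ i \<noteq> 0)}. score p}"
    proof (rule image_subsetI)
      fix \<theta> assume \<theta>: "\<theta> \<in> ?T"
      define s where "s = 1 / (\<Prod>j\<in>UNIV. segment_sum (\<theta> $ j))"
      have "s \<noteq> 0" "\<forall>i. \<theta> $ i \<noteq> 0" using T[OF \<theta>] unfolding s_def by simp_all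
      moreover have "score (monomial_map ?L s \<theta>)"
        using score[of \<theta> s] T[OF \<theta>] \<theta> unfolding s_def by blast
      moreover have "cube_point \<theta> = monomial_map ?L s \<theta>"
        by (simp only: cube_point_def s_def)
      ultimately show "cube_point \<theta> \<in> {p \<in> {monomial_map ?L s \<theta> | s \<theta>. s \<noteq> 0 \<and> (\<forall>i. \<theta> $ i \<noteq> 0)}. score p}"
        by auto
    qed
  qed
  finally show ?thesis .
qed

text \<open>
  The coordinates at \<open>0\<close> and at the unit vectors recover \<open>s\<close> and \<open>s \<theta>\<^sub>i\<close>.
\<close>

lemma inj_on_cube_point: "inj_on cube_point {\<theta> :: complex^'d. \<forall>i. \<theta> $ i \<in> segment_solutions (b i)}"
proof (rule inj_onI)
  fix \<theta> \<eta> :: "complex^'d"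
  assume \<theta>: "\<theta> \<in> {\<theta>. \<forall>i. \<theta> $ i \<in> segment_solutions (b i)}" and eq: "cube_point \<theta> = cube_point \<eta>"
  define s where "s = (\<lambda>\<theta> :: complex^'d. 1 / (\<Prod>j\<in>UNIV. segment_sum (\<theta> $ j)))"
  have "segment_sum (\<theta> $ i) \<noteq> 0" for i using \<theta> segment_sum_nonzero by blast
  then have "s \<theta> \<noteq> 0" by (simp add: s_def)
  have zero: "cube_point x 0 = s x" for x :: "complex^'d"
    unfolding cube_point_def s_def
    by (rule monomial_map_zero[OF zero_in_lattice_points_cube])
  have axis: "cube_point x (axis i 1) = s x * x $ i" for x :: "complex^'d" and i
    unfolding cube_point_def s_def
    by (rule monomial_map_axis[OF axis_in_lattice_points_cube])
  have "s \<theta> = s \<eta>" "s \<theta> * \<theta> $ i = s \<eta> * \<eta> $ i" for i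
    using eq zero[of \<theta>] zero[of \<eta>] axis[of \<theta> i] axis[of \<eta> i] by metis+
  then have "\<theta> $ i = \<eta> $ i" for i
    using \<open>s \<theta> \<noteq> 0\<close> by (metis mult_left_cancel)
  then show "\<theta> = \<eta>" by (simp add: vec_eq_iff)
qed

section \<open>The ML degree\<close>

text \<open>
  The score equations have \<open>2\<^sup>d\<close> solutions as soon as \<open>u\<^sub>0 \<noteq> 0\<close>, so the coordinate \<open>x\<^sub>0\<close> can
  serve as the polynomial that cuts out the exceptional data.
\<close>

theorem theorem5p3:
  shows "has_ML_degree (cube :: (real^'d) set) (2 ^ CARD('d))"
proof -
  define f :: "(int^'d) cpoly" where "f = Poly_Mapping.single (Poly_Mapping.single 0 1) 1"
  have "f \<in> cpolys (lattice_points (cube :: (real^'d) set))" "f \<noteq> 0"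
    by (simp_all add: f_def cpolys_def zero_in_lattice_points_cube flip: keys_eq_empty)
  moreover have "finite (score_solutions cube u) \<and> card (score_solutions cube u) = 2 ^ CARD('d)"
    if u: "data_total cube u > 0" "eval_cpoly f (\<lambda>a. of_nat (u a)) \<noteq> 0" for u :: "int^'d \<Rightarrow> nat"
  proof -
    let ?B = "\<lambda>i. segment_solutions (of_real (data_mean u i))"
    have "u 0 > 0" using u(2) by (simp add: f_def)
    then have two: "card (?B i) = 2" for i
      by (intro card_segment_solutions abs_data_mean_less_1)
    have "finite (?B i)" for i
      by (rule card_ge_0_finite) (simp add: two)
    then have "finite {\<theta> :: complex^'d. \<forall>i. \<theta> $ i \<in> ?B i}"
      by (rule finite_vec_box)
    moreover have "card {\<theta> :: complex^'d. \<forall>i. \<theta> $ i \<in> ?B i} = 2 ^ CARD('d)"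
      unfolding card_vec_box two by (rule prod_constant)
    ultimately show ?thesis
      unfolding score_solutions_cube[OF u(1)]
      by (simp only: card_image[OF inj_on_cube_point] finite_imageI)
  qed
  ultimately show ?thesis unfolding has_ML_degree_def by blast
qed

end
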